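(* Let $n,k$ be integers with $k<n<2k$. Then exactly as follows: (1) if $k$ is odd, then $Q_{n/k}$ is a core; (2) if $n<2k-1$ and $k$ is even, then $Q_{(n-1)/(k-1)}$ is the core of $Q_{n/k}$; (3) if $n=2k-1$ and $k$ is even, then $Q_{n/k}$ is homomorphically equivalent to $Q_{(n-1)/(k-1)}$.
   Context: For positive integers $m,j$, $Q_{m/j}$ denotes the Cayley graph on $\mathbb{Z}_2^m$ (group operation bitwise XOR) whose connection set is the set of all elements of weight at least $j$; i.e. vertices are $\mathbb{Z}_2^m$ and $x\sim y$ iff $x+y$ has at least $j$ nonzero coordinates. A homomorphism $G\to H$ is an adjacency-preserving map $V(G)\to V(H)$. A graph is a core if every homomorphism from it to itself is an automorphism; the core of a graph $G$ is the (unique up to isomorphism) vertex-minimal subgraph of $G$ to which $G$ admits a homomorphism. $G$ and $H$ are homomorphically equivalent if $G\to H$ and $H\to G$. *)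

theory Defs
  imports Main
begin

type_synonym 'a graph = "'a set \<times> ('a \<Rightarrow> 'a \<Rightarrow> bool)"

definition verts :: "'a graph \<Rightarrow> 'a set" where "verts G = fst G"
definition adj :: "'a graph \<Rightarrow> 'a \<Rightarrow> 'a \<Rightarrow> bool" where "adj G = snd G"

text \<open>Elements of Z_2^m are encoded as subsets of {0..<m} (the support of the vector);
  bitwise XOR is symmetric difference and the weight is the cardinality.\<close>
definition hweight :: "nat set \<Rightarrow> nat" where "hweight x = card x"
definition xorv :: "nat set \<Rightarrow> nat set \<Rightarrow> nat set" where "xorv x y = (x - y) \<union> (y - x)"

definition Qgraph :: "nat \<Rightarrow> nat \<Rightarrow> nat set graph" where
  "Qgraph m j = (Pow {..<m},
     (\<lambda>x y. x \<in> Pow {..<m} \<and> y \<in> Pow {..<m} \<and> hweight (xorv x y) \<ge> j))"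

definition is_hom :: "'a graph \<Rightarrow> 'b graph \<Rightarrow> ('a \<Rightarrow> 'b) \<Rightarrow> bool" where
  "is_hom G H f \<longleftrightarrow> (\<forall>x\<in>verts G. f x \<in> verts H) \<and>
     (\<forall>x\<in>verts G. \<forall>y\<in>verts G. adj G x y \<longrightarrow> adj H (f x) (f y))"

definition hom_exists :: "'a graph \<Rightarrow> 'b graph \<Rightarrow> bool" where
  "hom_exists G H \<longleftrightarrow> (\<exists>f. is_hom G H f)"

definition is_iso :: "'a graph \<Rightarrow> 'b graph \<Rightarrow> ('a \<Rightarrow> 'b) \<Rightarrow> bool" where
  "is_iso G H f \<longleftrightarrow> bij_betw f (verts G) (verts H) \<and>
     (\<forall>x\<in>verts G. \<forall>y\<in>verts G. adj G x y \<longleftrightarrow> adj H (f x) (f y))"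

definition isomorphic :: "'a graph \<Rightarrow> 'b graph \<Rightarrow> bool" where
  "isomorphic G H \<longleftrightarrow> (\<exists>f. is_iso G H f)"

definition is_core :: "'a graph \<Rightarrow> bool" where
  "is_core G \<longleftrightarrow> (\<forall>f. is_hom G G f \<longrightarrow> is_iso G G f)"

definition hom_equiv :: "'a graph \<Rightarrow> 'b graph \<Rightarrow> bool" where
  "hom_equiv G H \<longleftrightarrow> hom_exists G H \<and> hom_exists H G"

definition subgraph :: "'a graph \<Rightarrow> 'a graph \<Rightarrow> bool" where
  "subgraph S G \<longleftrightarrow> verts S \<subseteq> verts G \<and>
     (\<forall>x y. adj S x y \<longrightarrow> x \<in> verts S \<and> y \<in> verts S \<and> adj G x y \<and> adj S y x)"

definition is_core_of :: "'b graph \<Rightarrow> 'a graph \<Rightarrow> bool" where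
  "is_core_of H G \<longleftrightarrow> (\<exists>C. subgraph C G \<and> hom_exists G C \<and>
     (\<forall>S. subgraph S G \<and> hom_exists G S \<longrightarrow> card (verts C) \<le> card (verts S)) \<and>
     isomorphic H C)"

end

theory Submission
  imports Defs Complex_Main
begin

text \<open>
  For odd \<open>k\<close>, appending a parity bit identifies \<open>Q\<^bsub>n/k\<^esub>\<close> with the even-weight part of
  \<open>Q\<^bsub>N/K\<^esub>\<close>, where \<open>N = n + 1\<close> and \<open>K = k + 1\<close>; so an endomorphism of the former induces an
  endomorphism \<open>g\<close> of the latter. For every coordinate \<open>i\<close> put \<open>F\<^sub>i(x) = (-1)\<close> to the power
  \<open>g(x)\<^sub>i\<close> and sum \<open>F\<^sub>i(x) F\<^sub>i(y)\<close> over \<open>i\<close> and all pairs at distance exactly \<open>K\<close>. Since \<open>g\<close> maps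
  such pairs to pairs at distance at least \<open>K\<close>, the sum is at most \<open>N - 2K\<close> per pair; this is
  also the lower bound given by the least eigenvalue of the distance-\<open>K\<close> graph, a Krawtchouk value that is attained
  only by characters of weight \<open>1\<close> and \<open>N - 1\<close>. Hence equality holds, and on even-weight
  vectors each \<open>F\<^sub>i\<close> is a linear combination of coordinate characters. Being \<open>\<plusminus>1\<close>-valued, it is a
  single coordinate up to sign, so \<open>g\<close> is a permutation of coordinates followed by a translation
  there. The even case follows by deleting a coordinate and appending a parity bit.
\<close>

section \<open>Characters of the XOR group\<close>

lemma mem_xorv: "i \<in> xorv x y \<longleftrightarrow> (i \<in> x) \<noteq> (i \<in> y)"
  by (auto simp: xorv_def)

text \<open>The character with frequency set \<open>W\<close>. The product form makes it
  multiplicative in \<open>x\<close> without any finiteness condition and lets sums over all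
  \<open>W\<close> factor by coordinates.\<close>

definition chi :: "nat set \<Rightarrow> nat set \<Rightarrow> real" where
  "chi W x = (\<Prod>i\<in>W. if i \<in> x then -1 else 1)"

lemma chi_xorv: "chi W (xorv x y) = chi W x * chi W y"
  unfolding chi_def prod.distrib[symmetric] by (rule prod.cong) (auto simp: mem_xorv)

lemma chi_eq_power: "finite W \<Longrightarrow> chi W x = (-1) ^ card (W \<inter> x)"
  unfolding chi_def by (simp add: prod.If_cases)

lemma chi_commute:
  assumes "finite W" "finite x"
  shows "chi W x = chi x W"
  using assms by (simp add: chi_eq_power Int_commute)

text \<open>Orthogonality of characters: the sum factors over the coordinates in \<open>A\<close>,
  and each coordinate in \<open>z\<close> contributes the factor \<open>-1 + 1\<close>.\<close>

lemma sum_chi_Pow: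
  assumes "finite A"
  shows "(\<Sum>W\<in>Pow A. chi W z) = (if A \<inter> z = {} then 2 ^ card A else 0)"
proof -
  have "(\<Sum>W\<in>Pow A. chi W z) = (\<Prod>i\<in>A. (if i \<in> z then -1 else 1) + 1)"
    unfolding chi_def by (subst prod_add[OF assms]) simp
  also have "\<dots> = (\<Prod>i\<in>A. if i \<in> z then 0 else 2)"
    by (rule prod.cong) auto
  also have "\<dots> = (if A \<inter> z = {} then 2 ^ card A else 0)"
  proof (cases "A \<inter> z = {}")
    case True
    then have "(\<Prod>i\<in>A. if i \<in> z then 0 else 2) = (\<Prod>i\<in>A. 2 :: real)"
      by (intro prod.cong) auto
    then show ?thesis using True by simp
  qed (use assms in auto)
  finally show ?thesis .
qed

section \<open>Krawtchouk values and their bounds\<close>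

lemma chi_singleton: "finite W \<Longrightarrow> chi W {a} = (if a \<in> W then -1 else 1)"
  by (simp add: chi_eq_power)

text \<open>The value at \<open>card (W \<inter> A)\<close> of the \<open>M\<close>-th Krawtchouk polynomial for length \<open>card A\<close>.\<close>
definition kraw :: "nat set \<Rightarrow> nat \<Rightarrow> nat set \<Rightarrow> real" where
  "kraw A M W = (\<Sum>S | S \<subseteq> A \<and> card S = M. chi W S)"

lemma kraw_0: "finite A \<Longrightarrow> kraw A 0 W = 1"
proof -
  assume "finite A"
  then have "{S. S \<subseteq> A \<and> card S = 0} = {{}}"
    by (auto dest: finite_subset)
  then show ?thesis by (simp add: kraw_def chi_def)
qed

lemma kraw_1:
  assumes "finite A" "finite W"
  shows "kraw A 1 W = real (card A) - 2 * real (card (W \<inter> A))"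
proof -
  have "{S. S \<subseteq> A \<and> card S = 1} = (\<lambda>a. {a}) ` A"
    by (auto simp: card_1_singleton_iff)
  then have "kraw A 1 W = (\<Sum>a\<in>A. chi W {a})"
    by (simp add: kraw_def sum.reindex)
  also have "\<dots> = (\<Sum>a\<in>A. 1 - 2 * (if a \<in> W then 1 else 0))"
    using assms by (intro sum.cong) (auto simp: chi_singleton)
  also have "\<dots> = real (card A) - 2 * (\<Sum>a\<in>A. if a \<in> W then 1 else 0)"
    by (simp add: sum_subtractf sum_distrib_left)
  also have "(\<Sum>a\<in>A. if a \<in> W then 1 else 0) = real (card (W \<inter> A))"
    using assms by (simp add: sum.If_cases Int_commute)
  finally show ?thesis .
qed

text \<open>Pascal's rule with signs: sort the sets \<open>S\<close> by whether they contain
  \<open>a\<close>; those that do pick up the sign of \<open>a\<close> under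
  \<open>chi W\<close>.\<close>

lemma kraw_remove:
  assumes "finite A" "finite W" "a \<in> A"
  shows "kraw A (Suc M) W =
    kraw (A - {a}) (Suc M) W + (if a \<in> W then -1 else 1) * kraw (A - {a}) M W"
proof -
  let ?P = "{S. S \<subseteq> A - {a} \<and> card S = Suc M}" and ?Q = "{S. S \<subseteq> A - {a} \<and> card S = M}"
  have fin: "finite S" if "S \<subseteq> A" for S
    using that assms(1) by (rule finite_subset)
  have split: "{S. S \<subseteq> A \<and> card S = Suc M} = ?P \<union> insert a ` ?Q"
  proof (intro equalityI subsetI)
    fix S assume S: "S \<in> {S. S \<subseteq> A \<and> card S = Suc M}"
    show "S \<in> ?P \<union> insert a ` ?Q"
    proof (cases "a \<in> S")
      case True
      then have "S = insert a (S - {a})" "S - {a} \<in> ?Q"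
        using S fin by auto
      then show ?thesis by blast
    qed (use S in auto)
  next
    fix S assume "S \<in> ?P \<union> insert a ` ?Q"
    then show "S \<in> {S. S \<subseteq> A \<and> card S = Suc M}"
    proof
      assume "S \<in> insert a ` ?Q"
      then obtain T where T: "S = insert a T" "T \<subseteq> A - {a}" "card T = M" by blast
      moreover have "finite T" "a \<notin> T" using T fin[of T] by auto
      ultimately show ?thesis using assms(3) by auto
    qed auto
  qed
  have fin_sets: "finite ?P" "finite ?Q"
    using assms(1) by (auto intro: finite_subset[of _ "Pow A"])
  have inj: "inj_on (insert a) ?Q"
    by (rule inj_onI) blast
  have chi_insert: "chi W (insert a S) = (if a \<in> W then -1 else 1) * chi W S"
    if "S \<in> ?Q" for S
  proof -
    have "insert a S = xorv {a} S" using that by (auto simp: mem_xorv)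
    then show ?thesis by (simp only: chi_xorv chi_singleton[OF assms(2)])
  qed
  have "kraw A (Suc M) W = sum (chi W) ?P + sum (chi W) (insert a ` ?Q)"
    unfolding kraw_def split using fin_sets by (intro sum.union_disjoint) auto
  also have "sum (chi W) (insert a ` ?Q) = (\<Sum>S\<in>?Q. (if a \<in> W then -1 else 1) * chi W S)"
    unfolding sum.reindex[OF inj] comp_def by (intro sum.cong refl chi_insert)
  finally show ?thesis by (simp add: kraw_def sum_distrib_left)
qed

text \<open>Complementation in \<open>A\<close> matches the layers \<open>M\<close> and
  \<open>card A - M\<close> and multiplies \<open>chi W\<close> by the constant
  \<open>chi W A\<close>.\<close>

lemma kraw_complement:
  assumes "finite A" "finite W" "M \<le> card A"
  shows "kraw A (card A - M) W = (-1) ^ card (W \<inter> A) * kraw A M W"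
proof -
  have "bij_betw (\<lambda>S. A - S) {S. S \<subseteq> A \<and> card S = M} {S. S \<subseteq> A \<and> card S = card A - M}"
    using assms by (intro bij_betw_byWitness[where f' = "\<lambda>S. A - S"])
      (auto simp: card_Diff_subset finite_subset double_diff)
  then have "kraw A (card A - M) W = (\<Sum>S | S \<subseteq> A \<and> card S = M. chi W (A - S))"
    unfolding kraw_def by (rule sum.reindex_bij_betw[symmetric])
  also have "\<dots> = (\<Sum>S | S \<subseteq> A \<and> card S = M. chi W A * chi W S)"
  proof (rule sum.cong)
    fix S assume "S \<in> {S. S \<subseteq> A \<and> card S = M}"
    then have "A - S = xorv A S" by (auto simp: mem_xorv)
    then show "chi W (A - S) = chi W A * chi W S" by (simp only: chi_xorv)
  qed simp
  finally show ?thesis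
    using assms by (simp add: kraw_def sum_distrib_left chi_eq_power)
qed

text \<open>Serves inductions that delete points of \<open>A\<close> while \<open>W\<close> must
  stay at least \<open>r\<close> away from both extreme weights. A point of \<open>W\<close> is
  deleted if \<open>W\<close> can spare one; otherwise a point outside \<open>W\<close>, where
  \<open>2 * r < card A\<close> leaves room.\<close>

lemma obtain_element_keeping_margin:
  assumes "finite A" "0 < r" "r \<le> card (W \<inter> A)" "card (W \<inter> A) + r \<le> card A" "2 * r < card A"
  obtains a where "a \<in> A" "r \<le> card (W \<inter> (A - {a}))"
    "card (W \<inter> (A - {a})) + r \<le> card (A - {a})"
proof (cases "r < card (W \<inter> A)")
  case True
  then obtain a where a: "a \<in> W \<inter> A"
    by (metis card.empty equals0I not_less_zero)
  then have "card (W \<inter> (A - {a})) = card (W \<inter> A) - 1"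
    using assms(1) by (simp add: Int_Diff[symmetric])
  then show ?thesis using a True assms by (intro that[of a]) auto
next
  case False
  then have "card (W \<inter> A) < card A" using assms by auto
  then have "\<not> A \<subseteq> W" by (metis inf.absorb_iff2 less_irrefl)
  then obtain a where a: "a \<in> A" "a \<notin> W" by blast
  then have "W \<inter> (A - {a}) = W \<inter> A" by auto
  then show ?thesis using a False assms by (intro that[of a]) auto
qed

text \<open>Put \<open>b(n, M) = (n - 2M) / n * (n choose M)\<close>, the Krawtchouk value at weight
  1. For positive \<open>n\<close> this is Pascal's rule
  \<open>b(n+1, M+1) = b(n, M+1) + b(n, M)\<close>, cleared of denominators.\<close>

lemma binomial_bound_step:
  fixes n M :: nat
  shows "real n * ((real (Suc n) - 2 * real (Suc M)) * real (Suc n choose Suc M)) =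
    real (Suc n) * ((real n - 2 * real (Suc M)) * real (n choose Suc M)
      + (real n - 2 * real M) * real (n choose M))"
proof -
  define c0 c1 where "c0 = real (n choose M)" and "c1 = real (n choose Suc M)"
  have c: "real (Suc n choose Suc M) = c0 + c1"
    by (simp add: c0_def c1_def)
  have "Suc n * (n choose M) = (Suc n choose Suc M) * Suc M"
    by (rule Suc_times_binomial_eq)
  then have "real (Suc n) * c0 = real (Suc n choose Suc M) * real (Suc M)"
    unfolding c0_def of_nat_mult[symmetric] by (rule arg_cong)
  then have "real (Suc n) * c0 = (c0 + c1) * real (Suc M)"
    unfolding c .
  then have "(real n + 1) * c0 = (c0 + c1) * (real M + 1)"
    by (simp add: add.commute)
  then show ?thesis
    unfolding c c0_def[symmetric] c1_def[symmetric] by (simp add: field_simps)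
qed

text \<open>The triangle inequality in \<open>kraw_remove\<close>. By
  \<open>binomial_bound_step\<close> the two bounds add up exactly to the new one, so strictness in
  one summand survives.\<close>

lemma kraw_bound_step:
  assumes "finite A" "finite W" "a \<in> A" "2 \<le> card A"
  defines "B \<equiv> A - {a}"
  assumes 1: "real (card B) * \<bar>kraw B (Suc M) W\<bar> \<le>
      (real (card B) - 2 * real (Suc M)) * real (card B choose Suc M)"
    and 0: "real (card B) * \<bar>kraw B M W\<bar> \<le> (real (card B) - 2 * real M) * real (card B choose M)"
  shows "real (card A) * \<bar>kraw A (Suc M) W\<bar> \<le>
      (real (card A) - 2 * real (Suc M)) * real (card A choose Suc M)"
    and "real (card B) * \<bar>kraw B M W\<bar> < (real (card B) - 2 * real M) * real (card B choose M) \<Longrightarrow>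
      real (card A) * \<bar>kraw A (Suc M) W\<bar> <
      (real (card A) - 2 * real (Suc M)) * real (card A choose Suc M)"
proof -
  define n where "n = card B"
  have n: "card A = Suc n" "0 < n"
    using assms(1-4) by (simp_all add: n_def B_def card_Diff_singleton)
  let ?u = "(real n - 2 * real (Suc M)) * real (n choose Suc M)"
  let ?v = "(real n - 2 * real M) * real (n choose M)"
  let ?t = "(real (Suc n) - 2 * real (Suc M)) * real (Suc n choose Suc M)"
  have "\<bar>kraw A (Suc M) W\<bar> \<le> \<bar>kraw B (Suc M) W\<bar> + \<bar>kraw B M W\<bar>"
    unfolding kraw_remove[OF assms(1-3)] B_def by auto
  then have "real n * \<bar>kraw A (Suc M) W\<bar> \<le> real n * \<bar>kraw B (Suc M) W\<bar> + real n * \<bar>kraw B M W\<bar>"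
    by (simp add: distrib_left[symmetric] mult_left_mono)
  note le = this 0 1
  have eq: "real n * ?t = real (Suc n) * (?u + ?v)"
    by (rule binomial_bound_step)
  have "real n * \<bar>kraw A (Suc M) W\<bar> \<le> ?u + ?v"
    using le by (simp add: n_def)
  then have "real (Suc n) * (real n * \<bar>kraw A (Suc M) W\<bar>) \<le> real n * ?t"
    unfolding eq by (intro mult_left_mono) auto
  then have "real n * (real (Suc n) * \<bar>kraw A (Suc M) W\<bar>) \<le> real n * ?t"
    by (simp only: mult.left_commute)
  then show "real (card A) * \<bar>kraw A (Suc M) W\<bar> \<le>
      (real (card A) - 2 * real (Suc M)) * real (card A choose Suc M)"
    using n by (simp only: mult_le_cancel_left_pos of_nat_0_less_iff)
  assume "real (card B) * \<bar>kraw B M W\<bar> < (real (card B) - 2 * real M) * real (card B choose M)"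
  then have "real n * \<bar>kraw A (Suc M) W\<bar> < ?u + ?v"
    using le by (simp add: n_def)
  then have "real (Suc n) * (real n * \<bar>kraw A (Suc M) W\<bar>) < real n * ?t"
    unfolding eq by (intro mult_strict_left_mono) auto
  then have "real n * (real (Suc n) * \<bar>kraw A (Suc M) W\<bar>) < real n * ?t"
    by (simp only: mult.left_commute)
  then show "real (card A) * \<bar>kraw A (Suc M) W\<bar> <
      (real (card A) - 2 * real (Suc M)) * real (card A choose Suc M)"
    using n by (simp only: mult_less_cancel_left_pos of_nat_0_less_iff)
qed

text \<open>Complementation maps the middle layer to itself but reverses the sign, as
  \<open>chi W A = -1\<close>.\<close>

lemma kraw_middle_eq_0:
  assumes "finite A" "finite W" "card A = 2 * M" "odd (card (W \<inter> A))"
  shows "kraw A M W = 0"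
  using kraw_complement[of A W M] assms by simp

text \<open>
  Deleting one element of \<open>A\<close> carries the bound over exactly, except at \<open>card A = 2 * M + 1\<close>: there the
  element is chosen so that \<open>W\<close> keeps an odd number of elements, which makes the middle term vanish.
\<close>
lemma abs_kraw_le:
  assumes "finite A" "finite W" "0 < card (W \<inter> A)" "card (W \<inter> A) < card A" "2 * M < card A"
  shows "real (card A) * \<bar>kraw A M W\<bar> \<le> (real (card A) - 2 * real M) * real (card A choose M)"
  using assms
proof (induction "card A" arbitrary: A M rule: less_induct)
  case less
  show ?case
  proof (cases M)
    case 0
    then show ?thesis using less.prems by (simp add: kraw_0)
  next
    case (Suc m)
    have IH: "real (card (A - {a})) * \<bar>kraw (A - {a}) j W\<bar> \<le>
        (real (card (A - {a})) - 2 * real j) * real (card (A - {a}) choose j)"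
      if "a \<in> A" "0 < card (W \<inter> (A - {a}))" "card (W \<inter> (A - {a})) < card (A - {a})"
        "2 * j < card (A - {a})" for a j
      using less.prems that by (intro less.hyps) (auto simp: card_gt_0_iff)
    show ?thesis
    proof (cases "card A = 2 * M + 1")
      case False
      \<comment> \<open>Here \<open>card A > 2 * M + 1\<close>, so after the deletion both layers
        \<open>M\<close> and \<open>m\<close> are still within reach of the induction
        hypothesis.\<close>
      obtain a where a: "a \<in> A" "1 \<le> card (W \<inter> (A - {a}))"
          "card (W \<inter> (A - {a})) + 1 \<le> card (A - {a})"
        using less.prems Suc by (elim obtain_element_keeping_margin[of A 1 W, rotated -1]) auto
      show ?thesis
        unfolding Suc using a less.prems Suc False
        by (intro kraw_bound_step(1)[where a = a, OF _ _ _ _ IH IH]) auto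
    next
      case True
      obtain a where a: "a \<in> A" "odd (card (W \<inter> (A - {a})))"
      proof (cases "even (card (W \<inter> A))")
        case even: True
        obtain a where a: "a \<in> W \<inter> A"
          using less.prems by (metis card.empty equals0I less_irrefl)
        then have "card (W \<inter> (A - {a})) = card (W \<inter> A) - 1"
          using less.prems(1) by (simp add: Int_Diff[symmetric])
        then show ?thesis using a even less.prems(3) by (intro that[of a]) auto
      next
        case odd: False
        have "\<not> A \<subseteq> W" using less.prems(4) by (metis inf.absorb_iff2 less_irrefl)
        then obtain a where a: "a \<in> A" "a \<notin> W" by blast
        then have "W \<inter> (A - {a}) = W \<inter> A" by auto
        then show ?thesis using a odd by (intro that[of a]) auto
      qed
      have B: "card (A - {a}) = 2 * M" using a(1) True less.prems by simp
      \<comment> \<open>An odd count is neither 0 nor the even number \<open>2 * M\<close>, so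
        \<open>W\<close> remains strictly between the extremes.\<close>
      have "card (W \<inter> (A - {a})) \<le> card (A - {a})"
        using less.prems(1) by (intro card_mono) auto
      then have w: "0 < card (W \<inter> (A - {a}))" "card (W \<inter> (A - {a})) < card (A - {a})"
        using a(2) B by (auto simp: odd_pos le_less)
      have "kraw (A - {a}) (Suc m) W = 0"
        using kraw_middle_eq_0[of "A - {a}" W M] B a less.prems Suc by simp
      \<comment> \<open>Both sides are 0: on the right the factor
        \<open>card (A - {a}) - 2 * M\<close> vanishes.\<close>
      then have "real (card (A - {a})) * \<bar>kraw (A - {a}) (Suc m) W\<bar> \<le>
          (real (card (A - {a})) - 2 * real (Suc m)) * real (card (A - {a}) choose Suc m)"
        using B Suc by simp
      then show ?thesis
        unfolding Suc using a(1) less.prems Suc B w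
        by (intro kraw_bound_step(1)[where a = a, OF _ _ _ _ _ IH]) auto
    qed
  qed
qed

text \<open>Weights 1 and \<open>card A - 1\<close> attain the bound, hence the margin 2. Strictness
  starts at the explicit linear value for \<open>M = 1\<close> and passes upwards through the lower
  layer in \<open>kraw_bound_step\<close>; the upper layer only needs
  \<open>abs_kraw_le\<close>.\<close>

lemma abs_kraw_less:
  assumes "finite A" "finite W" "2 \<le> card (W \<inter> A)" "card (W \<inter> A) + 2 \<le> card A"
    "2 * M + 2 \<le> card A" "1 \<le> M"
  shows "real (card A) * \<bar>kraw A M W\<bar> < (real (card A) - 2 * real M) * real (card A choose M)"
  using assms(6,1-5)
proof (induction M arbitrary: A rule: dec_induct)
  case base
  have "\<bar>kraw A 1 W\<bar> < real (card A) - 2"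
    using base by (simp add: kraw_1[unfolded One_nat_def])
  then have "real (card A) * \<bar>kraw A 1 W\<bar> < real (card A) * (real (card A) - 2)"
    using base by (intro mult_strict_left_mono) auto
  then show ?case by (simp add: mult.commute)
next
  case (step M)
  obtain a where a: "a \<in> A" "2 \<le> card (W \<inter> (A - {a}))"
      "card (W \<inter> (A - {a})) + 2 \<le> card (A - {a})"
    using step.prems step.hyps by (elim obtain_element_keeping_margin[of A 2 W, rotated -1]) auto
  show ?case
    using a step.prems
    by (intro kraw_bound_step(2)[where a = a] abs_kraw_le step.IH) auto
qed

section \<open>Fourier analysis on subsets\<close>

text \<open>The Walsh-Hadamard transform, left unnormalised; hence the factors
  \<open>2 ^ card A\<close> below.\<close>

definition fourier :: "nat set \<Rightarrow> (nat set \<Rightarrow> real) \<Rightarrow> nat set \<Rightarrow> real" where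
  "fourier A F W = (\<Sum>x\<in>Pow A. F x * chi W x)"

lemma fourier_inversion:
  assumes "finite A" "x \<subseteq> A"
  shows "(\<Sum>W\<in>Pow A. fourier A F W * chi W x) = 2 ^ card A * F x"
proof -
  have "(\<Sum>W\<in>Pow A. fourier A F W * chi W x) = (\<Sum>W\<in>Pow A. \<Sum>y\<in>Pow A. F y * chi W (xorv y x))"
    by (simp add: fourier_def sum_distrib_right chi_xorv mult.assoc)
  also have "\<dots> = (\<Sum>y\<in>Pow A. F y * (\<Sum>W\<in>Pow A. chi W (xorv y x)))"
    by (subst sum.swap) (simp add: sum_distrib_left)
  also have "\<dots> = (\<Sum>y\<in>Pow A. if y = x then F x * 2 ^ card A else 0)"
  proof (rule sum.cong)
    fix y assume "y \<in> Pow A"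
    then have "A \<inter> xorv y x = {} \<longleftrightarrow> y = x"
      using assms(2) by (auto simp: xorv_def)
    then show "F y * (\<Sum>W\<in>Pow A. chi W (xorv y x)) = (if y = x then F x * 2 ^ card A else 0)"
      using assms(1) by (simp add: sum_chi_Pow)
  qed simp
  also have "\<dots> = 2 ^ card A * F x"
    using assms by simp
  finally show ?thesis .
qed

text \<open>Characters diagonalise the Cayley graph with connection set \<open>SS\<close>; its
  eigenvalue at \<open>W\<close> is the sum of \<open>chi W S\<close> over
  \<open>SS\<close>.\<close>

lemma fourier_quadratic_form:
  assumes "finite A" "SS \<subseteq> Pow A"
  shows "(\<Sum>W\<in>Pow A. (fourier A F W)\<^sup>2 * (\<Sum>S\<in>SS. chi W S)) =
    2 ^ card A * (\<Sum>x\<in>Pow A. \<Sum>S\<in>SS. F x * F (xorv x S))"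
proof -
  have "2 ^ card A * (\<Sum>x\<in>Pow A. \<Sum>S\<in>SS. F x * F (xorv x S))
      = (\<Sum>x\<in>Pow A. \<Sum>S\<in>SS. F x * (2 ^ card A * F (xorv x S)))"
    by (simp add: sum_distrib_left mult.left_commute)
  also have "\<dots> = (\<Sum>x\<in>Pow A. \<Sum>S\<in>SS. F x * (\<Sum>W\<in>Pow A. fourier A F W * chi W (xorv x S)))"
  proof (intro sum.cong refl)
    fix x S assume "x \<in> Pow A" "S \<in> SS"
    then have "xorv x S \<subseteq> A" using assms(2) by (auto simp: xorv_def)
    then show "F x * (2 ^ card A * F (xorv x S))
        = F x * (\<Sum>W\<in>Pow A. fourier A F W * chi W (xorv x S))"
      by (simp add: fourier_inversion[OF assms(1)])
  qed
  also have "\<dots> = (\<Sum>x\<in>Pow A. \<Sum>S\<in>SS. \<Sum>W\<in>Pow A. fourier A F W * (chi W S * (F x * chi W x)))"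
    by (simp add: sum_distrib_left chi_xorv mult_ac)
  also have "\<dots> = (\<Sum>x\<in>Pow A. \<Sum>W\<in>Pow A. \<Sum>S\<in>SS. fourier A F W * (chi W S * (F x * chi W x)))"
    by (intro sum.cong refl sum.swap)
  also have "\<dots> = (\<Sum>W\<in>Pow A. \<Sum>x\<in>Pow A. \<Sum>S\<in>SS. fourier A F W * (chi W S * (F x * chi W x)))"
    by (rule sum.swap)
  also have "\<dots> = (\<Sum>W\<in>Pow A. fourier A F W * ((\<Sum>S\<in>SS. chi W S) * fourier A F W))"
  proof (intro sum.cong refl)
    fix W
    have "(\<Sum>x\<in>Pow A. \<Sum>S\<in>SS. chi W S * (F x * chi W x)) = (\<Sum>S\<in>SS. chi W S) * fourier A F W"
      unfolding fourier_def sum_product by (rule sum.swap)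
    then show "(\<Sum>x\<in>Pow A. \<Sum>S\<in>SS. fourier A F W * (chi W S * (F x * chi W x)))
        = fourier A F W * ((\<Sum>S\<in>SS. chi W S) * fourier A F W)"
      by (simp add: sum_distrib_left[symmetric])
  qed
  finally show ?thesis by (simp add: power2_eq_square mult_ac)
qed

section \<open>The least eigenvalue of the distance-\<open>K\<close> graph\<close>

text \<open>\<open>K\<close> lies above the middle, so the bounds are applied to the layer
  \<open>card A - K\<close>. The hypothesis \<open>card A + 1 < 2 * K\<close> puts that layer in the
  range of \<open>abs_kraw_less\<close>.\<close>

lemma kraw_ge:
  assumes "finite A" "W \<subseteq> A" "even K" "K < card A" "card A + 1 < 2 * K"
  defines "l \<equiv> (real (card A) - 2 * real K) * real (card A choose K)"
  shows "l \<le> real (card A) * kraw A K W"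
    and "card W \<noteq> 1 \<Longrightarrow> card W \<noteq> card A - 1 \<Longrightarrow> l < real (card A) * kraw A K W"
proof -
  let ?N = "card A" and ?M = "card A - K"
  have W: "finite W" "W \<inter> A = W" using assms by (auto intro: finite_subset)
  have "kraw A (?N - ?M) W = (-1) ^ card W * kraw A ?M W"
    using assms W kraw_complement[of A W ?M] by simp
  then have "\<bar>kraw A K W\<bar> = \<bar>kraw A ?M W\<bar>"
    using assms by (simp add: abs_mult)
  moreover have "real (?N choose ?M) = real (?N choose K)" "real ?M = real ?N - real K"
    using assms binomial_symmetric[of K ?N] by auto
  ultimately have eq: "real ?N * \<bar>kraw A ?M W\<bar> = real ?N * \<bar>kraw A K W\<bar>"
      "(real ?N - 2 * real ?M) * real (?N choose ?M) = - l"
    by (simp_all add: l_def algebra_simps)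
  have le: "real ?N * \<bar>kraw A K W\<bar> \<le> - l" if "card W \<noteq> 0" "card W \<noteq> ?N"
    using abs_kraw_le[of A W ?M] that assms(1,4,5) W card_mono[OF assms(1,2)]
    unfolding eq by simp
  have less: "real ?N * \<bar>kraw A K W\<bar> < - l" if "2 \<le> card W" "card W + 2 \<le> ?N"
    using abs_kraw_less[of A W ?M] that assms(1,4,5) W
    unfolding eq by simp
  \<comment> \<open>The absolute bound fails for the empty and the full \<open>W\<close>. As
    \<open>K\<close> is even, both characters are 1 on every \<open>K\<close>-set, so the eigenvalue
    is positive while \<open>l < 0\<close>.\<close>
  have ends: "l < real ?N * kraw A K W" if "card W = 0 \<or> card W = ?N"
  proof -
    have "chi W S = 1" if S: "S \<subseteq> A" "card S = K" for S
    proof (cases "card W = 0")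
      case False
      then have "W = A" using \<open>card W = 0 \<or> card W = ?N\<close> assms by (simp add: card_subset_eq)
      then show ?thesis using S assms by (simp add: chi_eq_power Int_absorb1)
    qed (use W in \<open>simp add: chi_def\<close>)
    then have "kraw A K W = real (?N choose K)"
      using assms by (simp add: kraw_def n_subsets)
    moreover have "l < 0" unfolding l_def
      using assms by (intro mult_neg_pos) auto
    ultimately show ?thesis by (smt (verit) mult_nonneg_nonneg of_nat_0_le_iff)
  qed
  have abs_le: "- (real ?N * \<bar>kraw A K W\<bar>) \<le> real ?N * kraw A K W"
    using mult_left_mono[OF abs_ge_minus_self, of "real ?N" "kraw A K W"] by simp
  show "l \<le> real ?N * kraw A K W"
    using ends le abs_le by (cases "card W = 0 \<or> card W = ?N") auto
  show "l < real ?N * kraw A K W" if "card W \<noteq> 1" "card W \<noteq> ?N - 1"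
  proof (cases "card W = 0 \<or> card W = ?N")
    case False
    then have "2 \<le> card W" "card W + 2 \<le> ?N"
      using that card_mono[OF assms(1,2)] by linarith+
    then show ?thesis using less abs_le by linarith
  qed (rule ends)
qed

text \<open>A Rayleigh quotient argument: up to a positive factor,
  \<open>card A * Q - 2 ^ card A * l\<close> is the sum of the nonnegative gaps
  \<open>card A * kraw A K W - l\<close>, weighted by squared Fourier coefficients. Equality kills
  every coefficient whose gap is positive.\<close>

lemma quadratic_form_min:
  assumes "finite A" "even K" "K < card A" "card A + 1 < 2 * K"
    and F: "\<And>x. x \<subseteq> A \<Longrightarrow> (F x)\<^sup>2 = 1"
  defines "l \<equiv> (real (card A) - 2 * real K) * real (card A choose K)"
  defines "Q \<equiv> (\<Sum>x\<in>Pow A. \<Sum>S | S \<subseteq> A \<and> card S = K. F x * F (xorv x S))"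
  shows "2 ^ card A * l \<le> real (card A) * Q"
    and "2 ^ card A * l = real (card A) * Q \<Longrightarrow> W \<subseteq> A \<Longrightarrow> card W \<noteq> 1 \<Longrightarrow> card W \<noteq> card A - 1 \<Longrightarrow>
      fourier A F W = 0"
proof -
  let ?N = "card A"
  \<comment> \<open>The quadratic form for the connection set \<open>{{}}\<close>, all of whose
    eigenvalues are 1.\<close>
  have parseval: "(\<Sum>W\<in>Pow A. (fourier A F W)\<^sup>2) = 2 ^ ?N * 2 ^ ?N"
  proof -
    have "(\<Sum>x\<in>Pow A. F x * F x) = (\<Sum>x\<in>Pow A. 1)"
      by (intro sum.cong) (auto simp: F power2_eq_square[symmetric])
    then show ?thesis
      using fourier_quadratic_form[OF assms(1), of "{{}}" F]
      by (simp add: chi_def xorv_def card_Pow[OF assms(1)])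
  qed
  have "(\<Sum>W\<in>Pow A. (fourier A F W)\<^sup>2 * (real ?N * kraw A K W - l))
      = real ?N * (\<Sum>W\<in>Pow A. (fourier A F W)\<^sup>2 * kraw A K W) - l * (\<Sum>W\<in>Pow A. (fourier A F W)\<^sup>2)"
    by (simp add: algebra_simps sum_subtractf sum_distrib_left)
  also have "(\<Sum>W\<in>Pow A. (fourier A F W)\<^sup>2 * kraw A K W) = 2 ^ ?N * Q"
    unfolding Q_def kraw_def using assms(1) by (intro fourier_quadratic_form) auto
  finally have sum_eq: "(\<Sum>W\<in>Pow A. (fourier A F W)\<^sup>2 * (real ?N * kraw A K W - l))
      = 2 ^ ?N * (real ?N * Q - 2 ^ ?N * l)"
    by (simp add: parseval algebra_simps)
  have nonneg: "0 \<le> (fourier A F W)\<^sup>2 * (real ?N * kraw A K W - l)" if "W \<in> Pow A" for W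
    using kraw_ge(1)[of A W K] that assms by simp
  have "0 \<le> 2 ^ ?N * (real ?N * Q - 2 ^ ?N * l)"
    unfolding sum_eq[symmetric] by (intro sum_nonneg nonneg)
  then show "2 ^ ?N * l \<le> real ?N * Q"
    by (smt (verit) mult_pos_neg zero_less_power)
  assume eq: "2 ^ ?N * l = real ?N * Q" and W: "W \<subseteq> A" "card W \<noteq> 1" "card W \<noteq> ?N - 1"
  have "(\<Sum>W\<in>Pow A. (fourier A F W)\<^sup>2 * (real ?N * kraw A K W - l)) = 0"
    unfolding sum_eq using eq by simp
  then have "(fourier A F W)\<^sup>2 * (real ?N * kraw A K W - l) = 0"
    using sum_nonneg_eq_0_iff[OF _ nonneg, of "Pow A" "\<lambda>W. W"] assms(1) W(1) by blast
  moreover have "real ?N * kraw A K W - l > 0"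
    using kraw_ge(2)[of A W K] W assms by simp
  ultimately show "fourier A F W = 0" by simp
qed

section \<open>From the extremal eigenspace to single coordinates\<close>

text \<open>On an even set the full character is 1, so the characters of \<open>{j}\<close> and
  \<open>A - {j}\<close> agree and their coefficients merge into \<open>a j\<close>.\<close>

lemma linear_on_even_sets:
  assumes "finite A" "3 \<le> card A"
    and supp: "\<And>W. W \<subseteq> A \<Longrightarrow> card W \<noteq> 1 \<Longrightarrow> card W \<noteq> card A - 1 \<Longrightarrow> fourier A F W = 0"
  obtains a where "\<And>x. x \<subseteq> A \<Longrightarrow> even (card x) \<Longrightarrow> F x = (\<Sum>j\<in>A. a j * (if j \<in> x then -1 else 1))"
proof
  let ?N = "card A"
  let ?a = "\<lambda>j. (fourier A F {j} + fourier A F (A - {j})) / 2 ^ ?N"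
  fix x assume x: "x \<subseteq> A" "even (card x)"
  have fin: "finite x" using x assms by (auto intro: finite_subset)
  let ?h = "\<lambda>W. fourier A F W * chi W x"
  let ?P = "(\<lambda>j. {j}) ` A" and ?R = "(\<lambda>j. A - {j}) ` A"
  have cards: "card W = 1" if "W \<in> ?P" for W using that by auto
  have cards': "card W = ?N - 1" if "W \<in> ?R" for W using that assms(1) by auto
  have zero: "fourier A F W = 0" if "W \<in> Pow A - (?P \<union> ?R)" for W
  proof (rule supp)
    show "W \<subseteq> A" using that by auto
    then have "finite W" using assms(1) by (auto intro: finite_subset)
    show "card W \<noteq> 1" using that by (auto simp: card_1_singleton_iff)
    show "card W \<noteq> ?N - 1"
    proof
      assume "card W = ?N - 1"
      then have "card (A - W) = 1"
        using assms \<open>finite W\<close> \<open>W \<subseteq> A\<close> by (simp add: card_Diff_subset)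
      then obtain j where "A - W = {j}" by (auto simp: card_1_singleton_iff)
      then have "j \<in> A" "W = A - {j}" using \<open>W \<subseteq> A\<close> by auto
      then show False using that by auto
    qed
  qed
  \<comment> \<open>\<open>3 \<le> card A\<close> separates the sizes 1 and
    \<open>card A - 1\<close>; no coefficient is counted twice.\<close>
  have disj: "?P \<inter> ?R = {}"
  proof (rule equals0I)
    fix W assume "W \<in> ?P \<inter> ?R"
    then have "card W = 1" "card W = ?N - 1" using cards cards' by blast+
    then show False using assms(2) by simp
  qed
  have chi_co: "chi (A - {j}) x = chi {j} x" if "j \<in> A" for j
  proof -
    have "A - {j} = xorv A {j}" using that by (auto simp: mem_xorv)
    then have "chi x (A - {j}) = chi x A * chi x {j}" by (simp only: chi_xorv)
    moreover have "chi x A = 1" using x fin by (simp add: chi_eq_power Int_absorb2)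
    ultimately show ?thesis
      using fin assms(1) by (simp add: chi_commute[of _ x])
  qed
  have "2 ^ ?N * F x = sum ?h (Pow A)"
    using fourier_inversion[OF assms(1) x(1)] by simp
  also have "\<dots> = sum ?h (?P \<union> ?R)"
    using assms(1) zero by (intro sum.mono_neutral_right) auto
  also have "\<dots> = sum ?h ?P + sum ?h ?R"
    using assms(1) disj by (intro sum.union_disjoint) auto
  also have "sum ?h ?P = (\<Sum>j\<in>A. fourier A F {j} * chi {j} x)"
    by (simp add: sum.reindex)
  also have "sum ?h ?R = (\<Sum>j\<in>A. fourier A F (A - {j}) * chi {j} x)"
  proof -
    have "inj_on (\<lambda>j. A - {j}) A" by (rule inj_onI) blast
    then show ?thesis by (simp add: sum.reindex chi_co)
  qed
  finally have "2 ^ ?N * F x = (\<Sum>j\<in>A. (fourier A F {j} + fourier A F (A - {j})) * chi {j} x)"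
    by (simp add: sum.distrib distrib_right)
  then have "F x = (\<Sum>j\<in>A. (fourier A F {j} + fourier A F (A - {j})) * chi {j} x) / 2 ^ ?N"
    by (simp add: field_simps)
  then show "F x = (\<Sum>j\<in>A. ?a j * (if j \<in> x then -1 else 1))"
    by (simp add: sum_divide_distrib chi_def)
qed

text \<open>Sums of \<open>a\<close> over even sets can only be 0 or the total \<open>T\<close>.
  Pairs then force one coefficient \<open>T\<close> and zeros elsewhere, or at least
  \<open>card A - 1\<close> coefficients equal to \<open>T / 2\<close>; the latter is refuted by
  four of them, whose sum is \<open>2 * T\<close>. Five coordinates leave four after one
  exception.\<close>

lemma boolean_linear_is_dictator:
  fixes a :: "nat \<Rightarrow> real"
  assumes "finite A" "5 \<le> card A"
    and F: "\<And>x. x \<subseteq> A \<Longrightarrow> even (card x) \<Longrightarrow> F x = (\<Sum>j\<in>A. a j * (if j \<in> x then -1 else 1))"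
    and pm: "\<And>x. x \<subseteq> A \<Longrightarrow> F x = 1 \<or> F x = -1"
  obtains p t where "p \<in> A" "t = 1 \<or> t = -1"
    "\<And>x. x \<subseteq> A \<Longrightarrow> even (card x) \<Longrightarrow> F x = t * (if p \<in> x then -1 else 1)"
proof -
  define T where "T = sum a A"
  have F_eq: "F x = T - 2 * sum a x" if "x \<subseteq> A" "even (card x)" for x
  proof -
    have "F x = (\<Sum>j\<in>A. a j - 2 * (if j \<in> x then a j else 0))"
      unfolding F[OF that] by (intro sum.cong) auto
    also have "\<dots> = T - 2 * (\<Sum>j\<in>A. if j \<in> x then a j else 0)"
      by (simp add: sum_subtractf sum_distrib_left T_def)
    also have "(\<Sum>j\<in>A. if j \<in> x then a j else 0) = sum a x"
      using that assms(1) by (simp add: sum.inter_restrict[symmetric] Int_absorb1)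
    finally show ?thesis .
  qed
  have T: "T = 1 \<or> T = -1" using F_eq[of "{}"] pm[of "{}"] by simp
  have sums: "sum a x = 0 \<or> sum a x = T" if "x \<subseteq> A" "even (card x)" for x
    using F_eq[OF that] pm[OF that(1)] T by auto
  have two: "a p + a q = 0 \<or> a p + a q = T" if "p \<in> A" "q \<in> A" "p \<noteq> q" for p q
    using sums[of "{p, q}"] that by simp
  have four: "\<not> (\<forall>q\<in>x. a q = T / 2)" if "x \<subseteq> A" "card x = 4" for x
  proof
    assume "\<forall>q\<in>x. a q = T / 2"
    then have "sum a x = (\<Sum>q\<in>x. T / 2)" by (intro sum.cong) auto
    then have "sum a x = 2 * T" using that by simp
    then show False using sums[of x] that T by auto
  qed
  have third: "\<exists>r\<in>A. r \<notin> S" if "finite S" "card S < 5" for S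
    using that assms(2) card_mono[of S A] by fastforce
  have "\<exists>p\<in>A. a p = T \<and> (\<forall>q\<in>A. q \<noteq> p \<longrightarrow> a q = 0)"
  proof (cases "\<exists>p\<in>A. \<exists>q\<in>A. a p \<noteq> a q")
    case False
    have "4 \<le> card A" using assms(2) by simp
    then obtain x where x: "x \<subseteq> A" "card x = 4"
      using obtain_subset_with_card_n by metis
    obtain p where "p \<in> A" using third[of "{}"] by auto
    moreover obtain q where "q \<in> A" "q \<noteq> p" using third[of "{p}"] by auto
    ultimately have pq: "p \<in> A" "q \<in> A" "p \<noteq> q" by auto
    have eq: "a r = a p" if "r \<in> A" for r using False pq that by blast
    have "a p \<noteq> 0"
    proof
      assume "a p = 0"
      then have "T = 0" unfolding T_def using eq by (intro sum.neutral) simp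
      then show False using T by simp
    qed
    then have "a p = T / 2" using two[OF pq] eq[OF pq(2)] by simp
    then have "\<forall>r\<in>x. a r = T / 2" using eq x by auto
    then show ?thesis using four x by blast
  next
    case True
    then obtain p q where pq: "p \<in> A" "q \<in> A" "a p \<noteq> a q" by blast
    \<comment> \<open>Compare both coefficients with a common third partner
      \<open>r\<close>.\<close>
    have diff: "a u - a v = 0 \<or> a u - a v = T \<or> a u - a v = - T" if "u \<in> A" "v \<in> A" for u v
    proof (cases "u = v")
      case False
      obtain r where "r \<in> A" "r \<noteq> u" "r \<noteq> v"
        using third[of "{u, v}"] False by auto
      then show ?thesis using two[of u r] two[of v r] that by auto
    qed simp
    have "a p = a q + T \<or> a q = a p + T"
      using diff[OF pq(1,2)] pq(3) by auto
    then obtain p q where pq: "p \<in> A" "q \<in> A" "a p = a q + T" using pq by blast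
    have neq: "p \<noteq> q" using pq T by auto
    have others: "(a r + a q = 0 \<or> a r + a q = T) \<and> (a r + a p = 0 \<or> a r + a p = T)"
      if "r \<in> A - {p, q}" for r
      using two[of r q] two[of r p] pq that by auto
    \<comment> \<open>The pair sum \<open>a p + a q = 2 * a q + T\<close> is 0 or
      \<open>T\<close>.\<close>
    have "a q = 0 \<or> a q = - T / 2" using two[OF pq(1,2) neq] pq(3) T by auto
    then show ?thesis
    proof
      assume "a q = 0"
      moreover have "a r = 0" if "r \<in> A - {p, q}" for r
        using others[OF that] \<open>a q = 0\<close> pq(3) T by auto
      ultimately have "\<forall>r\<in>A. r \<noteq> p \<longrightarrow> a r = 0" by blast
      then show ?thesis using pq \<open>a q = 0\<close> by auto
    next
      assume q: "a q = - T / 2"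
      have half: "a r = T / 2" if "r \<in> A - {q}" for r
        using others[of r] that q pq(3) T by (cases "r = p") auto
      have "4 \<le> card (A - {q})" using assms pq by simp
      then obtain x where "x \<subseteq> A - {q}" "card x = 4"
        using obtain_subset_with_card_n by metis
      then show ?thesis using four[of x] half by blast
    qed
  qed
  then obtain p where p: "p \<in> A" "a p = T" "\<And>q. q \<in> A \<Longrightarrow> q \<noteq> p \<Longrightarrow> a q = 0" by blast
  show thesis
  proof (rule that[OF p(1) T])
    fix x assume x: "x \<subseteq> A" "even (card x)"
    have "sum a x = (\<Sum>j\<in>x. if j = p then T else 0)"
      using p x by (intro sum.cong) auto
    also have "\<dots> = (if p \<in> x then T else 0)"
      using finite_subset[OF x(1) assms(1)] by simp
    finally show "F x = T * (if p \<in> x then -1 else 1)"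
      using F_eq[OF x] by simp
  qed
qed

text \<open>An exchange argument: if \<open>p\<close> has an empty fibre, replacing \<open>p\<close>
  by \<open>q\<close> in a \<open>K\<close>-set keeps the preimage count, so the fibre of every
  other \<open>q\<close> is empty too. Then \<open>j p\<close> has no possible value.\<close>

lemma uniform_preimages_imp_surj:
  assumes "finite A" "0 < K" "K < card A" "\<And>i. i \<in> A \<Longrightarrow> j i \<in> A"
    and uniform: "\<And>S. S \<subseteq> A \<Longrightarrow> card S = K \<Longrightarrow> card {i \<in> A. j i \<in> S} = K"
  shows "j ` A = A"
proof (rule ccontr)
  assume "j ` A \<noteq> A"
  then obtain p where p: "p \<in> A" "p \<notin> j ` A" using assms(4) by blast
  have "{i \<in> A. j i = q} = {}" if q: "q \<in> A" "q \<noteq> p" for q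
  proof -
    have "K - 1 \<le> card (A - {p, q})" using assms p q by (simp add: card_Diff_subset)
    then obtain R where R: "R \<subseteq> A - {p, q}" "card R = K - 1" "finite R"
      using obtain_subset_with_card_n by metis
    then have "card {i \<in> A. j i \<in> insert p R} = card {i \<in> A. j i \<in> insert q R}"
      using assms(2) p q by (subst (1 2) uniform) (auto simp: card_insert_if)
    also have "{i \<in> A. j i \<in> insert p R} = {i \<in> A. j i \<in> R}" using p by auto
    also have "{i \<in> A. j i \<in> insert q R} = {i \<in> A. j i \<in> R} \<union> {i \<in> A. j i = q}" by auto
    also have "card \<dots> = card {i \<in> A. j i \<in> R} + card {i \<in> A. j i = q}"
      using R assms(1) by (intro card_Un_disjoint) auto
    finally show ?thesis using assms(1) by simp
  qed
  then have "j p = p" using p(1) assms(4) by blast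
  then show False using p by force
qed

section \<open>Rigidity of endomorphisms on even-weight vectors\<close>

lemma hom_inj_on_even_sets:
  assumes A: "finite A" "even K" "K < card A" "card A + 1 < 2 * K"
    and g: "\<And>x. x \<subseteq> A \<Longrightarrow> g x \<subseteq> A"
    and hom: "\<And>x y. x \<subseteq> A \<Longrightarrow> y \<subseteq> A \<Longrightarrow> K \<le> card (xorv x y) \<Longrightarrow> K \<le> card (xorv (g x) (g y))"
  shows "inj_on g {x. x \<subseteq> A \<and> even (card x)}"
proof -
  let ?N = "card A"
  \<comment> \<open>\<open>K = 2\<close> leaves no room for \<open>card A\<close>, so evenness gives
    \<open>K \<ge> 4\<close>.\<close>
  have N: "5 \<le> ?N" using A(2-4) by presburger
  define F where "F i x = (if i \<in> g x then -1 else 1 :: real)" for i x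
  let ?SS = "{S. S \<subseteq> A \<and> card S = K}"
  define Q where "Q i = (\<Sum>x\<in>Pow A. \<Sum>S\<in>?SS. F i x * F i (xorv x S))" for i
  define l where "l = (real ?N - 2 * real K) * real (?N choose K)"
  \<comment> \<open>The excess of the image distance over \<open>K\<close>.\<close>
  define D where "D x S = real (card (xorv (g x) (g (xorv x S)))) - real K" for x S
  have fin: "finite ?SS" using A(1) by (auto intro: finite_subset[of _ "Pow A"])
  have F_prod: "(\<Sum>i\<in>A. F i x * F i y) = real ?N - 2 * real (card (xorv (g x) (g y)))"
    if "x \<subseteq> A" "y \<subseteq> A" for x y
  proof -
    have "(\<Sum>i\<in>A. F i x * F i y) = (\<Sum>i\<in>A. 1 - 2 * (if i \<in> xorv (g x) (g y) then 1 else 0))"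
      by (intro sum.cong) (auto simp: F_def mem_xorv)
    also have "\<dots> = real ?N - 2 * (\<Sum>i\<in>A. if i \<in> xorv (g x) (g y) then 1 else 0)"
      by (simp add: sum_subtractf sum_distrib_left)
    also have "(\<Sum>i\<in>A. if i \<in> xorv (g x) (g y) then 1 else 0) = real (card (A \<inter> xorv (g x) (g y)))"
      using A(1) by (simp add: sum.If_cases)
    also have "A \<inter> xorv (g x) (g y) = xorv (g x) (g y)"
      using g[OF that(1)] g[OF that(2)] by (auto simp: xorv_def)
    finally show ?thesis .
  qed
  have sub: "xorv x S \<subseteq> A" if "x \<in> Pow A" "S \<in> ?SS" for x S
    using that by (auto simp: xorv_def)
  have D: "0 \<le> D x S" if xS: "x \<in> Pow A" "S \<in> ?SS" for x S
  proof -
    have "xorv x (xorv x S) = S" by (auto simp: mem_xorv)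
    then show ?thesis using hom[OF _ sub[OF xS]] xS by (simp add: D_def)
  qed
  define E where "E = (\<Sum>x\<in>Pow A. \<Sum>S\<in>?SS. D x S)"
  have "0 \<le> E" unfolding E_def by (intro sum_nonneg D)
  have Q_ge: "0 \<le> real ?N * Q i - 2 ^ ?N * l" for i
    using quadratic_form_min(1)[OF A, of "F i"] unfolding Q_def l_def by (simp add: F_def)
  \<comment> \<open>Summing over the coordinates first turns the products into distances, so the
    total depends only on the total excess \<open>E\<close>.\<close>
  have "sum Q A = (\<Sum>x\<in>Pow A. \<Sum>i\<in>A. \<Sum>S\<in>?SS. F i x * F i (xorv x S))"
    unfolding Q_def by (rule sum.swap)
  also have "\<dots> = (\<Sum>x\<in>Pow A. \<Sum>S\<in>?SS. \<Sum>i\<in>A. F i x * F i (xorv x S))"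
    by (intro sum.cong refl sum.swap)
  also have "\<dots> = (\<Sum>x\<in>Pow A. \<Sum>S\<in>?SS. (real ?N - 2 * real K) - 2 * D x S)"
    using sub by (intro sum.cong refl) (subst F_prod, auto simp: D_def)
  also have "\<dots> = (\<Sum>x\<in>Pow A. \<Sum>S\<in>?SS. real ?N - 2 * real K) - 2 * E"
    by (simp only: sum_subtractf sum_distrib_left[symmetric] E_def)
  also have "(\<Sum>x\<in>Pow A. \<Sum>S\<in>?SS. real ?N - 2 * real K) = 2 ^ ?N * l"
    using A(1) by (simp add: l_def n_subsets card_Pow)
  finally have sum_Q: "sum Q A = 2 ^ ?N * l - 2 * E" .
  have "(\<Sum>i\<in>A. real ?N * Q i - 2 ^ ?N * l) = real ?N * sum Q A - real ?N * (2 ^ ?N * l)"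
    by (simp add: sum_subtractf sum_distrib_left)
  then have sum_Q: "(\<Sum>i\<in>A. real ?N * Q i - 2 ^ ?N * l) = - 2 * real ?N * E"
    unfolding sum_Q by (simp add: algebra_simps)
  \<comment> \<open>The terms are nonnegative, yet their sum is a nonpositive multiple of
    \<open>E \<ge> 0\<close>; so \<open>E\<close> and every term vanish.\<close>
  have "0 \<le> (\<Sum>i\<in>A. real ?N * Q i - 2 ^ ?N * l)" by (intro sum_nonneg Q_ge)
  then have "real ?N * E \<le> 0" unfolding sum_Q by (simp add: mult.commute)
  then have "E = 0" using \<open>0 \<le> E\<close> N by (simp add: mult_le_0_iff)
  have Q_eq: "2 ^ ?N * l = real ?N * Q i" if "i \<in> A" for i
  proof -
    have "(\<Sum>i\<in>A. real ?N * Q i - 2 ^ ?N * l) = 0" unfolding sum_Q using \<open>E = 0\<close> by simp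
    then show ?thesis using sum_nonneg_eq_0_iff[OF A(1), of "\<lambda>i. real ?N * Q i - 2 ^ ?N * l"] Q_ge that
      by simp
  qed
  have D_eq: "D x S = 0" if "x \<in> Pow A" "S \<in> ?SS" for x S
  proof -
    have "(\<Sum>S\<in>?SS. D x S) = 0"
      using \<open>E = 0\<close> that(1) A(1) unfolding E_def
      by (subst (asm) sum_nonneg_eq_0_iff) (auto intro!: sum_nonneg D)
    then show ?thesis
      using that fin by (subst (asm) sum_nonneg_eq_0_iff) (auto intro!: D)
  qed
  have "\<exists>p t. p \<in> A \<and> (t = 1 \<or> t = -1) \<and>
      (\<forall>x. x \<subseteq> A \<longrightarrow> even (card x) \<longrightarrow> F i x = t * (if p \<in> x then -1 else 1))" if i: "i \<in> A" for i
  proof -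
    obtain a where a: "\<And>x. x \<subseteq> A \<Longrightarrow> even (card x) \<Longrightarrow>
        F i x = (\<Sum>j\<in>A. a j * (if j \<in> x then -1 else 1))"
    proof (rule linear_on_even_sets[OF A(1), of "F i"])
      show "3 \<le> ?N" using N by simp
      fix W assume "W \<subseteq> A" "card W \<noteq> 1" "card W \<noteq> ?N - 1"
      then show "fourier A (F i) W = 0"
        using Q_eq[OF i] unfolding l_def Q_def
        by (intro quadratic_form_min(2)[OF A]) (simp_all add: F_def)
    qed blast
    have pm: "F i x = 1 \<or> F i x = -1" for x by (simp add: F_def)
    obtain p t where "p \<in> A" "t = 1 \<or> t = -1"
        "\<And>x. x \<subseteq> A \<Longrightarrow> even (card x) \<Longrightarrow> F i x = t * (if p \<in> x then -1 else 1)"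
      using boolean_linear_is_dictator[OF A(1) N a pm] by blast
    then show ?thesis by blast
  qed
  then obtain j t where j: "\<And>i. i \<in> A \<Longrightarrow> j i \<in> A" and t: "\<And>i. i \<in> A \<Longrightarrow> t i = 1 \<or> t i = -1"
    and jt: "\<And>i x. i \<in> A \<Longrightarrow> x \<subseteq> A \<Longrightarrow> even (card x) \<Longrightarrow> F i x = t i * (if j i \<in> x then -1 else 1)"
    by metis
  have mem: "i \<in> xorv (g x) (g y) \<longleftrightarrow> j i \<in> xorv x y"
    if "i \<in> A" "x \<subseteq> A" "even (card x)" "y \<subseteq> A" "even (card y)" for i x y
    using jt[OF that(1-3)] jt[OF that(1,4,5)] t[OF that(1)]
    by (auto simp: F_def mem_xorv split: if_splits)
  \<comment> \<open>Comparing \<open>S\<close> with \<open>{}\<close> exhibits the preimage of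
    \<open>S\<close> under \<open>j\<close> as an image difference, whose size is \<open>K\<close>
    as the excess is 0.\<close>
  have "card {i \<in> A. j i \<in> S} = K" if S: "S \<subseteq> A" "card S = K" for S
  proof -
    have "{i \<in> A. j i \<in> S} = xorv (g {}) (g S)"
      using mem[of _ "{}" S] S A(2) g[of "{}"] g[of S] by (auto simp: xorv_def)
    then show ?thesis using D_eq[of "{}" S] S by (simp add: D_def xorv_def)
  qed
  then have surj: "j ` A = A"
    using A j by (intro uniform_preimages_imp_surj[where K = K]) auto
  show ?thesis
  proof (rule inj_onI)
    fix x y assume xy: "x \<in> {x. x \<subseteq> A \<and> even (card x)}" "y \<in> {x. x \<subseteq> A \<and> even (card x)}" "g x = g y"
    then have "j i \<notin> xorv x y" if "i \<in> A" for i
      using mem[of i x y] that by (auto simp: mem_xorv)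
    then have "\<forall>q\<in>j ` A. q \<notin> xorv x y" by simp
    then show "x = y" unfolding surj using xy by (auto simp: mem_xorv)
  qed
qed

section \<open>Parity extension and coordinate deletion between the graphs\<close>

lemma verts_Qgraph: "verts (Qgraph m j) = Pow {..<m}"
  by (simp add: verts_def Qgraph_def)

lemma adj_Qgraph: "adj (Qgraph m j) x y \<longleftrightarrow> x \<subseteq> {..<m} \<and> y \<subseteq> {..<m} \<and> j \<le> card (xorv x y)"
  by (simp add: adj_def Qgraph_def hweight_def)

lemma is_hom_comp: "is_hom G H f \<Longrightarrow> is_hom H L g \<Longrightarrow> is_hom G L (\<lambda>x. g (f x))"
  by (simp add: is_hom_def)

text \<open>By finiteness, an injective endomorphism also permutes the set of adjacent pairs, so it
  reflects adjacency.\<close>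

lemma injective_endomorphism_is_iso:
  assumes "finite (verts G)" "is_hom G G f" "inj_on f (verts G)"
  shows "is_iso G G f"
proof -
  let ?V = "verts G"
  define E where "E = {(x, y) \<in> ?V \<times> ?V. adj G x y}"
  have fin: "finite E" unfolding E_def using assms(1) by (auto intro: finite_subset[of _ "?V \<times> ?V"])
  have "f ` ?V = ?V"
    using assms by (intro endo_inj_surj) (auto simp: is_hom_def)
  moreover have "map_prod f f ` E = E"
  proof (rule endo_inj_surj[OF fin])
    show "map_prod f f ` E \<subseteq> E" using assms(2) by (auto simp: E_def is_hom_def)
    show "inj_on (map_prod f f) E"
      using assms(3) by (auto simp: E_def inj_on_def)
  qed
  then have "adj G x y" if xy: "x \<in> ?V" "y \<in> ?V" "adj G (f x) (f y)" for x y
  proof -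
    have "(f x, f y) \<in> map_prod f f ` E"
      unfolding \<open>map_prod f f ` E = E\<close> using xy assms(2) by (auto simp: E_def is_hom_def)
    then obtain u v where "(u, v) \<in> E" "f x = f u" "f y = f v" by auto
    then show ?thesis using xy assms(3) by (auto simp: E_def dest: inj_onD)
  qed
  ultimately show ?thesis
    using assms(2,3) unfolding is_iso_def bij_betw_def is_hom_def by blast
qed

lemma even_card_xorv:
  assumes "finite x" "finite y"
  shows "even (card (xorv x y)) \<longleftrightarrow> even (card x + card y)"
proof -
  have "card (xorv x y) = card (x - y) + card (y - x)"
    unfolding xorv_def using assms by (intro card_Un_disjoint) auto
  moreover have "card x = card (x - y) + card (x \<inter> y)" "card y = card (y - x) + card (x \<inter> y)"
    using assms card_Int_Diff[of x y] card_Int_Diff[of y x] by (simp_all add: Int_commute)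
  ultimately show ?thesis by presburger
qed

definition parity_ext :: "nat \<Rightarrow> nat set \<Rightarrow> nat set" where
  "parity_ext n x = (if even (card x) then x else insert n x)"

lemma parity_ext_subset: "x \<subseteq> {..<n} \<Longrightarrow> parity_ext n x \<subseteq> {..<Suc n}"
  by (auto simp: parity_ext_def)

lemma even_card_parity_ext: "x \<subseteq> {..<n} \<Longrightarrow> even (card (parity_ext n x))"
  using finite_subset[of x "{..<n}"] by (auto simp: parity_ext_def card_insert_if)

lemma parity_ext_remove: "x \<subseteq> {..<n} \<Longrightarrow> parity_ext n x - {n} = x"
  by (auto simp: parity_ext_def)

lemma inj_on_parity_ext: "inj_on (parity_ext n) (Pow {..<n})"
  by (rule inj_on_inverseI[where g = "\<lambda>x. x - {n}"]) (simp add: parity_ext_remove)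

text \<open>Even-weight vectors are at even distance, so a distance at least the odd
  \<open>k\<close> becomes at least \<open>k + 1\<close>.\<close>

lemma is_hom_parity_ext:
  assumes "odd k"
  shows "is_hom (Qgraph n k) (Qgraph (Suc n) (Suc k)) (parity_ext n)"
proof -
  have "Suc k \<le> card (xorv (parity_ext n x) (parity_ext n y))"
    if xy: "x \<subseteq> {..<n}" "y \<subseteq> {..<n}" "k \<le> card (xorv x y)" for x y
  proof -
    let ?z = "xorv (parity_ext n x) (parity_ext n y)"
    have fin: "finite (parity_ext n x)" "finite (parity_ext n y)"
      using xy parity_ext_subset by (meson finite_lessThan finite_subset)+
    then have "finite ?z" by (simp add: xorv_def)
    moreover have "xorv x y \<subseteq> ?z"
      using xy by (auto simp: xorv_def parity_ext_def)
    ultimately have "k \<le> card ?z" using xy(3) card_mono order_trans by blast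
    moreover have "even (card ?z)"
      using fin xy by (simp add: even_card_xorv even_card_parity_ext)
    ultimately show ?thesis using assms by (metis Suc_leI le_neq_implies_less)
  qed
  then show ?thesis
    using parity_ext_subset by (auto simp: is_hom_def verts_Qgraph adj_Qgraph)
qed

lemma is_hom_remove: "is_hom (Qgraph (Suc n) (Suc k)) (Qgraph n k) (\<lambda>x. x - {n})"
proof -
  have "k \<le> card (xorv (x - {n}) (y - {n}))" if "Suc k \<le> card (xorv x y)" for x y
  proof -
    have "xorv (x - {n}) (y - {n}) = xorv x y - {n}" by (auto simp: mem_xorv)
    then show ?thesis using that diff_card_le_card_Diff[of "{n}" "xorv x y"] by simp
  qed
  then show ?thesis
    by (auto simp: is_hom_def verts_Qgraph adj_Qgraph lessThan_Suc)
qed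

section \<open>Cores\<close>

lemma is_core_Qgraph:
  assumes "odd k" "k < n" "n < 2 * k"
  shows "is_core (Qgraph n k)"
  unfolding is_core_def
proof (intro allI impI)
  fix f assume f: "is_hom (Qgraph n k) (Qgraph n k) f"
  define g where "g x = parity_ext n (f (x - {n}))" for x
  have "is_hom (Qgraph (Suc n) (Suc k)) (Qgraph (Suc n) (Suc k)) g"
    unfolding g_def using is_hom_comp[OF is_hom_comp[OF is_hom_remove f] is_hom_parity_ext[OF assms(1)]] .
  \<comment> \<open>With \<open>A = {..<Suc n}\<close> and \<open>K = Suc k\<close>, the condition
    \<open>card A + 1 < 2 * K\<close> reads \<open>n < 2 * k\<close>.\<close>
  then have inj: "inj_on g {x. x \<subseteq> {..<Suc n} \<and> even (card x)}"
    using assms by (intro hom_inj_on_even_sets[where K = "Suc k"])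
      (auto simp: is_hom_def verts_Qgraph adj_Qgraph)
  have "inj_on f (Pow {..<n})"
  proof (rule inj_onI)
    fix x y assume xy: "x \<in> Pow {..<n}" "y \<in> Pow {..<n}" "f x = f y"
    then have "g (parity_ext n x) = g (parity_ext n y)"
      by (simp add: g_def parity_ext_remove)
    then have "parity_ext n x = parity_ext n y"
      by (rule inj_onD[OF inj]) (use xy in \<open>simp_all add: parity_ext_subset even_card_parity_ext\<close>)
    then show "x = y" using xy by (metis PowD parity_ext_remove)
  qed
  then show "is_iso (Qgraph n k) (Qgraph n k) f"
    using f by (intro injective_endomorphism_is_iso) (simp_all add: verts_Qgraph)
qed

text \<open>The parity extensions induce a copy of \<open>Qgraph n k\<close>. It is minimal: a
  homomorphism to a subgraph \<open>S\<close> induces an endomorphism of the core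
  \<open>Qgraph n k\<close>, whose injectivity gives \<open>S\<close> at least as many
  vertices.\<close>

lemma is_core_of_Qgraph_Suc:
  assumes "odd k" "k < n" "n < 2 * k"
  shows "is_core_of (Qgraph n k) (Qgraph (Suc n) (Suc k))"
proof -
  let ?G = "Qgraph (Suc n) (Suc k)" and ?H = "Qgraph n k" and ?e = "parity_ext n"
  define V where "V = ?e ` Pow {..<n}"
  define C where "C = (V, \<lambda>x y. x \<in> V \<and> y \<in> V \<and> adj ?G x y)"
  have C: "verts C = V" "adj C x y \<longleftrightarrow> x \<in> V \<and> y \<in> V \<and> adj ?G x y" for x y
    by (simp_all add: C_def verts_def adj_def)
  have V: "V \<subseteq> verts ?G" unfolding V_def verts_Qgraph using parity_ext_subset by auto
  have e: "is_hom ?H ?G ?e" using assms(1) by (rule is_hom_parity_ext)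
  then have e': "is_hom ?H C ?e" unfolding is_hom_def C by (auto simp: V_def verts_Qgraph)
  have "xorv x y = xorv y x" for x y by (auto simp: mem_xorv)
  then have "subgraph C ?G" unfolding subgraph_def C using V by (auto simp: adj_Qgraph)
  moreover have "hom_exists ?G C"
    unfolding hom_exists_def using is_hom_comp[OF is_hom_remove e'] by blast
  moreover have "is_iso ?H C ?e"
    unfolding is_iso_def
  proof (intro conjI ballI iffI)
    show "bij_betw ?e (verts ?H) (verts C)"
      unfolding C V_def verts_Qgraph using inj_on_parity_ext by (rule inj_on_imp_bij_betw)
    fix x y assume xy: "x \<in> verts ?H" "y \<in> verts ?H"
    show "adj C (?e x) (?e y)" if "adj ?H x y" using e' xy that by (auto simp: is_hom_def)
    \<comment> \<open>Deleting coordinate \<open>n\<close> undoes \<open>?e\<close> and is itself a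
      homomorphism, so adjacency is reflected.\<close>
    assume "adj C (?e x) (?e y)"
    then have "adj ?H (?e x - {n}) (?e y - {n})"
      using is_hom_remove[of n k] V unfolding is_hom_def C by blast
    then show "adj ?H x y" using xy by (simp add: verts_Qgraph parity_ext_remove)
  qed
  moreover have "card (verts C) \<le> card (verts S)" if S: "subgraph S ?G" "hom_exists ?G S" for S
  proof -
    obtain h where h: "is_hom ?G S h" using S(2) by (auto simp: hom_exists_def)
    then have "is_hom ?G ?G h" using S(1) by (auto simp: is_hom_def subgraph_def)
    then have "is_hom ?H ?H (\<lambda>x. h (?e x) - {n})"
      by (rule is_hom_comp[OF is_hom_comp[OF e] is_hom_remove])
    then have "inj_on (\<lambda>x. h (?e x) - {n}) (Pow {..<n})"
      using is_core_Qgraph[OF assms] unfolding is_core_def is_iso_def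
      by (auto simp: verts_Qgraph bij_betw_def)
    then have "inj_on (\<lambda>x. h (?e x)) (Pow {..<n})"
      unfolding inj_on_def by metis
    moreover have "(\<lambda>x. h (?e x)) ` Pow {..<n} \<subseteq> verts S"
      using h V unfolding V_def is_hom_def by blast
    moreover have "finite (verts S)"
      using S(1) by (auto simp: subgraph_def verts_Qgraph intro: finite_subset)
    ultimately have "card (Pow {..<n}) \<le> card (verts S)" by (rule card_inj_on_le)
    then show ?thesis
      unfolding C V_def using inj_on_parity_ext by (simp add: card_image)
  qed
  ultimately show ?thesis
    unfolding is_core_of_def isomorphic_def by blast
qed

theorem theorem4p14:
  fixes n k :: nat
  assumes "k < n" and "n < 2 * k"
  shows "(odd k \<longrightarrow> is_core (Qgraph n k))
    \<and> (n < 2 * k - 1 \<and> even k \<longrightarrow> is_core_of (Qgraph (n - 1) (k - 1)) (Qgraph n k))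
    \<and> (n = 2 * k - 1 \<and> even k \<longrightarrow> hom_equiv (Qgraph n k) (Qgraph (n - 1) (k - 1)))"
proof (intro conjI impI)
  show "is_core (Qgraph n k)" if "odd k"
    using that assms by (rule is_core_Qgraph)
  obtain m j where mj: "n = Suc m" "k = Suc j"
    using assms by (metis less_nat_zero_code mult_0_right not0_implies_Suc)
  \<comment> \<open>\<open>n < 2 * k - 1\<close> amounts to \<open>m < 2 * j\<close>, the range in
    which \<open>Qgraph m j\<close> is known to be a core.\<close>
  show "is_core_of (Qgraph (n - 1) (k - 1)) (Qgraph n k)" if "n < 2 * k - 1 \<and> even k"
    using is_core_of_Qgraph_Suc[of j m] that assms by (simp add: mj)
  \<comment> \<open>Now \<open>m = 2 * j\<close> lies just outside that range; the deletion and
    parity homomorphisms still exist.\<close>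
  show "hom_equiv (Qgraph n k) (Qgraph (n - 1) (k - 1))" if "n = 2 * k - 1 \<and> even k"
    unfolding hom_equiv_def hom_exists_def
    using is_hom_remove[of m j] is_hom_parity_ext[of j m] that by (auto simp: mj)
qed

end
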